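(* Let $\mathcal{H}$ be a separable complex Hilbert space, $A\in L(\mathcal{H})$, $I$ an at most countable index set, and $f_i\in\mathcal{H}$, $i\in I$. The system $\mathcal{A}=(A^nf_i)_{n\in\mathbb{N},\,i\in I}$ is a frame for $\mathcal{H}$ if and only if the following conditions are satisfied. (i) $A^*$ is strongly stable. (ii) $(f_i)_{i\in I}$ is a Bessel sequence. (iii) There exists a boundedly invertible operator $S\in L(\mathcal{H})$ such that $$ASA^*=S-F,$$ where $F$ is the frame operator of $(f_i)_{i\in I}$. If the conditions (i)--(iii) are satisfied, then the operator $S$ in (iii) is necessarily the frame operator of $\mathcal{A}$.
   Context: $\mathbb{N}=\{0,1,2,\dots\}$. $L(\mathcal{H})$ is the set of bounded linear operators on $\mathcal{H}$. An operator $T\in L(\mathcal{H})$ is strongly stable if $T^nf\to0$ as $n\to\infty$ for each $f\in\mathcal{H}$. The frame operator of a Bessel sequence $(g_k)_{k\in K}$ is the bounded operator $f\mapsto\sum_{k\in K}\langle f,g_k\rangle g_k$ on $\mathcal{H}$. *)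

theory Defs
  imports "HOL-Analysis.Analysis"
begin

text \<open>
  The inner product is linear in the first argument. Its real part is the real inner product of
  the superclass, which supplies the norm and the topology; positive definiteness and
  \<open>norm x = sqrt (cinner x x)\<close> are derived below.
\<close>

class complex_inner = real_inner +
  fixes scaleC :: "complex \<Rightarrow> 'a \<Rightarrow> 'a" (infixr "*\<^sub>C" 75)
    and cinner :: "'a \<Rightarrow> 'a \<Rightarrow> complex"
  assumes scaleC_add_right: "a *\<^sub>C (x + y) = a *\<^sub>C x + a *\<^sub>C y"
    and scaleC_add_left: "(a + b) *\<^sub>C x = a *\<^sub>C x + b *\<^sub>C x"
    and scaleC_scaleC: "a *\<^sub>C b *\<^sub>C x = (a * b) *\<^sub>C x"
    and scaleC_of_real: "complex_of_real r *\<^sub>C x = r *\<^sub>R x"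
    and cinner_commute: "cinner x y = cnj (cinner y x)"
    and cinner_add_left: "cinner (x + y) z = cinner x z + cinner y z"
    and cinner_scaleC_left: "cinner (a *\<^sub>C x) y = a * cinner x y"
    and Re_cinner: "Re (cinner x y) = inner x y"

class chilbert_space = complex_inner + complete_space

lemma scaleC_one: "1 *\<^sub>C x = (x :: 'a::complex_inner)"
  using scaleC_of_real[of 1 x] by simp

lemma cinner_self: "cinner x x = complex_of_real ((norm (x :: 'a::complex_inner))\<^sup>2)"
proof -
  have "Im (cinner x x) = 0"
    using arg_cong[OF cinner_commute[of x x], of Im] by simp
  then show ?thesis
    by (simp add: complex_eq_iff Re_cinner power2_norm_eq_inner)
qed

lemma cinner_self_eq_zero_iff: "cinner x x = 0 \<longleftrightarrow> x = (0 :: 'a::complex_inner)"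
  by (simp add: cinner_self)

lemma norm_eq_sqrt_cinner: "norm (x :: 'a::complex_inner) = sqrt (Re (cinner x x))"
  by (simp add: cinner_self)

instantiation complex :: chilbert_space
begin

definition scaleC_complex :: "complex \<Rightarrow> complex \<Rightarrow> complex"
  where "scaleC_complex a x = a * x"

definition cinner_complex :: "complex \<Rightarrow> complex \<Rightarrow> complex"
  where "cinner_complex x y = x * cnj y"

instance
  by standard (simp_all add: scaleC_complex_def cinner_complex_def algebra_simps
      inner_complex_def scaleR_conv_of_real)

end

definition bounded_clinear :: "('a::complex_inner \<Rightarrow> 'b::complex_inner) \<Rightarrow> bool"
  where "bounded_clinear T \<longleftrightarrow> bounded_linear T \<and> (\<forall>c x. T (c *\<^sub>C x) = c *\<^sub>C T x)"

definition boundedly_invertible :: "('a::complex_inner \<Rightarrow> 'a) \<Rightarrow> bool"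
  where "boundedly_invertible S \<longleftrightarrow> (\<exists>T. bounded_clinear T \<and> S \<circ> T = id \<and> T \<circ> S = id)"

text \<open>Analogue of \<^const>\<open>adjoint\<close>, which refers to the real inner product.\<close>

definition cadjoint :: "('a::complex_inner \<Rightarrow> 'b::complex_inner) \<Rightarrow> 'b \<Rightarrow> 'a"
  where "cadjoint T = (SOME T'. \<forall>x y. cinner (T x) y = cinner x (T' y))"

definition strongly_stable :: "('a::real_normed_vector \<Rightarrow> 'a) \<Rightarrow> bool"
  where "strongly_stable T \<longleftrightarrow> (\<forall>x. (\<lambda>n. (T ^^ n) x) \<longlonglongrightarrow> 0)"

text \<open>
  Families are indexed by the set \<open>K\<close>; values of \<open>g\<close> outside \<open>K\<close> are irrelevant. Summability is
  required explicitly because \<^const>\<open>infsum\<close> is 0 on families that are not summable.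
\<close>

definition bessel_sequence :: "'k set \<Rightarrow> ('k \<Rightarrow> 'a::complex_inner) \<Rightarrow> bool"
  where "bessel_sequence K g \<longleftrightarrow>
    (\<exists>b>0. \<forall>x. (\<lambda>k. (cmod (cinner x (g k)))\<^sup>2) summable_on K \<and>
       (\<Sum>\<^sub>\<infinity>k\<in>K. (cmod (cinner x (g k)))\<^sup>2) \<le> b * (norm x)\<^sup>2)"

definition is_frame :: "'k set \<Rightarrow> ('k \<Rightarrow> 'a::complex_inner) \<Rightarrow> bool"
  where "is_frame K g \<longleftrightarrow>
    (\<exists>a>0. \<exists>b>0. \<forall>x. (\<lambda>k. (cmod (cinner x (g k)))\<^sup>2) summable_on K \<and>
       a * (norm x)\<^sup>2 \<le> (\<Sum>\<^sub>\<infinity>k\<in>K. (cmod (cinner x (g k)))\<^sup>2) \<and>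
       (\<Sum>\<^sub>\<infinity>k\<in>K. (cmod (cinner x (g k)))\<^sup>2) \<le> b * (norm x)\<^sup>2)"

definition frame_operator :: "'k set \<Rightarrow> ('k \<Rightarrow> 'a::complex_inner) \<Rightarrow> 'a \<Rightarrow> 'a"
  where "frame_operator K g x = (\<Sum>\<^sub>\<infinity>k\<in>K. cinner x (g k) *\<^sub>C g k)"

definition orbit_system :: "('a \<Rightarrow> 'a) \<Rightarrow> ('i \<Rightarrow> 'a) \<Rightarrow> nat \<times> 'i \<Rightarrow> 'a"
  where "orbit_system A f = (\<lambda>(n, i). (A ^^ n) (f i))"

end

theory Submission
  imports Defs
begin

text \<open>
  Write \<open>S\<close> for the frame operator of the orbit system and \<open>F\<close> for that of the generators.
  Since \<open>cinner x ((A ^^ n) (f i)) = cinner ((cadjoint A ^^ n) x) (f i)\<close>, one has formally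
  \<open>S = (\<Sum>n. A ^^ n \<circ> F \<circ> cadjoint A ^^ n)\<close>, a geometric series. Dropping its first term shows
  \<open>A \<circ> S \<circ> cadjoint A = S - F\<close> as soon as the orbit system is a Bessel sequence
  (\<open>frame_operator_orbit_system_stein\<close>).

  A sequence is a frame if and only if it is Bessel with boundedly invertible frame operator
  (\<open>is_frame_iff_boundedly_invertible_frame_operator\<close>). So for a frame, \<open>S\<close> itself is the
  required solution. Moreover the partial sums of the series exhibit
  \<open>inner (S u) u\<close>, for \<open>u\<close> the \<open>n\<close>th iterate of \<open>x\<close> under \<open>cadjoint A\<close>, as the tail of a
  convergent series of real numbers; as \<open>S\<close> is bounded below, \<open>cadjoint A\<close> is strongly stable
  (\<open>strongly_stable_cadjoint_if_is_frame\<close>).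

  Conversely let \<open>S'\<close> be any bounded solution of the equation. Iterating it \<open>n\<close> times gives
  the \<open>n\<close>th partial sum of the series plus \<open>A ^^ n \<circ> S' \<circ> cadjoint A ^^ n\<close>, and under strong
  stability this remainder tends to 0 in the weak sense. Evaluated on the diagonal this says that
  the squared coefficients of \<open>x\<close> sum to \<open>inner (S' x) x\<close>, so the orbit system is Bessel
  (\<open>bessel_sequence_orbit_system_if_stein\<close>). Applied to the difference of two solutions it
  says that the difference vanishes (\<open>stein_solution_unique\<close>), whence \<open>S' = S\<close>. If \<open>S'\<close> is
  boundedly invertible, then so is \<open>S\<close>, and the orbit system is a frame.

  Existence of adjoints and of the inverse of a frame operator both come from representing a bounded
  functional by a coercive symmetric form (\<open>symmetric_coercive_representation\<close>).
\<close>

section \<open>Complex inner products\<close>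

lemma cinner_add_right: "cinner x (y + z) = cinner x y + cinner x (z :: 'a::complex_inner)"
  by (metis cinner_commute cinner_add_left complex_cnj_add)

lemma cinner_scaleC_right: "cinner x (a *\<^sub>C y) = cnj a * cinner x (y :: 'a::complex_inner)"
  by (metis cinner_commute cinner_scaleC_left complex_cnj_mult)

lemma cinner_diff_left: "cinner (x - y) z = cinner x z - cinner y (z :: 'a::complex_inner)"
  using cinner_add_left[of "x - y" y z] by simp

lemma scaleR_eq_scaleC: "r *\<^sub>R x = complex_of_real r *\<^sub>C (x :: 'a::complex_inner)"
  by (simp add: scaleC_of_real)

lemma Im_cinner: "Im (cinner x y) = - inner (\<i> *\<^sub>C x) (y :: 'a::complex_inner)"
  by (simp add: Re_cinner[symmetric] cinner_scaleC_left)

lemma eq_if_cinner_left_eq: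
  fixes x y :: "'a::complex_inner"
  assumes "\<And>z. cinner z x = cinner z y"
  shows "x = y"
proof -
  have "cinner (x - y) (x - y) = 0"
    by (metis assms cinner_commute cinner_diff_left diff_self)
  then show ?thesis by (simp add: cinner_self_eq_zero_iff)
qed

lemma norm_scaleC: "norm (a *\<^sub>C x) = cmod a * norm (x :: 'a::complex_inner)"
proof -
  have "complex_of_real ((norm (a *\<^sub>C x))\<^sup>2) = a * cnj a * cinner x x"
    by (simp only: cinner_self[symmetric] cinner_scaleC_left cinner_scaleC_right mult_ac)
  also have "\<dots> = complex_of_real ((cmod a * norm x)\<^sup>2)"
    by (simp add: cinner_self power_mult_distrib flip: complex_norm_square)
  finally have "(norm (a *\<^sub>C x))\<^sup>2 = (cmod a * norm x)\<^sup>2"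
    using of_real_eq_iff by blast
  then show ?thesis by simp
qed

text \<open>
  Rotating \<open>x\<close> by a unimodular factor makes \<open>cinner x y\<close> real, and then the real
  Cauchy--Schwarz inequality applies.
\<close>

lemma cmod_cinner_le: "cmod (cinner x y) \<le> norm x * norm (y :: 'a::complex_inner)"
proof (cases "cinner x y = 0")
  case False
  define a where "a = cnj (cinner x y) / cmod (cinner x y)"
  have "cmod (cinner x y) = Re (a * cinner x y)"
    using False by (simp add: a_def complex_norm_square[symmetric] mult.commute power2_eq_square
        flip: of_real_mult)
  also have "\<dots> = inner (a *\<^sub>C x) y"
    by (simp add: Re_cinner[symmetric] cinner_scaleC_left)
  also have "\<dots> \<le> norm (a *\<^sub>C x) * norm y" by (rule norm_cauchy_schwarz)
  also have "norm (a *\<^sub>C x) = norm x"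
    using False by (simp add: norm_scaleC a_def norm_divide)
  finally show ?thesis .
qed simp

lemma bounded_linear_cinner_left: "bounded_linear (\<lambda>x. cinner x (y :: 'a::complex_inner))"
  by (rule bounded_linear_intro[where K = "norm y"])
    (simp_all add: cinner_add_left cinner_scaleC_left scaleC_of_real[symmetric]
      scaleC_complex_def cmod_cinner_le)

lemma bounded_clinearI:
  fixes T :: "'a::complex_inner \<Rightarrow> 'b::complex_inner"
  assumes "\<And>x y. T (x + y) = T x + T y" "\<And>c x. T (c *\<^sub>C x) = c *\<^sub>C T x"
    "\<And>x. norm (T x) \<le> norm x * K"
  shows "bounded_clinear T"
  unfolding bounded_clinear_def
  using assms by (auto intro!: bounded_linear_intro simp: scaleR_eq_scaleC)

lemma bounded_clinear_bounded_linear: "bounded_clinear T \<Longrightarrow> bounded_linear T"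
  and bounded_clinear_scaleC: "bounded_clinear T \<Longrightarrow> T (c *\<^sub>C x) = c *\<^sub>C T x"
  by (auto simp: bounded_clinear_def)

section \<open>Representation of functionals and adjoints\<close>

text \<open>
  The representing vector is the minimiser of \<open>J x = B x x - 2 * \<phi> x\<close>. Coercivity bounds
  \<open>J\<close> from below, and the parallelogram identity makes every minimising sequence Cauchy.
  For \<open>B = inner\<close> this is the Riesz representation theorem; for \<open>B x y = inner (S x) y\<close> it says
  that a coercive symmetric operator \<open>S\<close> is onto.
\<close>

lemma symmetric_coercive_representation:
  fixes B :: "'a::{real_inner, complete_space} \<Rightarrow> 'a \<Rightarrow> real"
  assumes B: "bounded_bilinear B" and sym: "\<And>x y. B x y = B y x"
    and a: "a > 0" and coercive: "\<And>x. a * (norm x)\<^sup>2 \<le> B x x"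
    and \<phi>: "bounded_linear \<phi>"
  obtains z where "\<And>x. B z x = \<phi> x"
proof -
  interpret B: bounded_bilinear B by fact
  interpret \<phi>: bounded_linear \<phi> by fact
  define J where "J x = B x x - 2 * \<phi> x" for x
  define m where "m = Inf (range J)"
  obtain K where K: "\<And>x. norm (\<phi> x) \<le> norm x * K" using \<phi>.bounded by blast
  have "- K\<^sup>2 / a \<le> J x" for x
  proof -
    have "0 \<le> (a * norm x - K)\<^sup>2 / a" using a by simp
    also have "\<dots> = a * (norm x)\<^sup>2 - 2 * (norm x * K) + K\<^sup>2 / a"
      using a by (simp add: field_simps power2_eq_square)
    finally show ?thesis using K[of x] coercive[of x] by (simp add: J_def)
  qed
  then have bdd: "bdd_below (range J)" by (rule bdd_belowI2)
  then have m_le: "m \<le> J x" for x unfolding m_def by (rule cInf_lower[rotated]) simp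
  have "\<exists>x. J x < m + inverse (Suc n)" for n
    using cInf_lessD[of "range J" "m + inverse (Suc n)"] by (auto simp: m_def)
  then obtain u where u: "\<And>n. J (u n) < m + inverse (Suc n)" by metis
  have parallelogram: "a / 2 * (norm (x - y))\<^sup>2 \<le> J x + J y - 2 * m" for x y
  proof -
    have "J x + J y = 2 * J ((1/2) *\<^sub>R (x + y)) + B (x - y) (x - y) / 2"
      by (simp add: J_def B.add_left B.add_right B.diff_left B.diff_right B.scaleR_left
          B.scaleR_right \<phi>.add \<phi>.scaleR sym[of y x] field_simps)
    then show ?thesis
      using coercive[of "x - y"] m_le[of "(1/2) *\<^sub>R (x + y)"] by simp
  qed
  have "Cauchy u"
    unfolding Cauchy_def
  proof (intro allI impI)
    fix e :: real assume e: "e > 0"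
    then obtain N where N: "inverse (real (Suc N)) < a * e\<^sup>2 / 4"
      using reals_Archimedean[of "a * e\<^sup>2 / 4"] a by auto
    have "dist (u i) (u j) < e" if "i \<ge> N" "j \<ge> N" for i j
    proof -
      have "inverse (real (Suc i)) \<le> inverse (real (Suc N))"
        "inverse (real (Suc j)) \<le> inverse (real (Suc N))"
        using that by (auto intro!: le_imp_inverse_le)
      then have "a / 2 * (norm (u i - u j))\<^sup>2 < a / 2 * e\<^sup>2"
        using parallelogram[of "u i" "u j"] u[of i] u[of j] N by linarith
      then have "(norm (u i - u j))\<^sup>2 < e\<^sup>2" using a by simp
      then show ?thesis using e by (simp add: dist_norm power_less_imp_less_base)
    qed
    then show "\<exists>M. \<forall>i\<ge>M. \<forall>j\<ge>M. dist (u i) (u j) < e" by blast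
  qed
  then obtain z where z: "u \<longlonglongrightarrow> z" using Cauchy_convergent convergent_def by blast
  have "(\<lambda>n. J (u n)) \<longlonglongrightarrow> J z"
    unfolding J_def by (intro tendsto_intros B.tendsto \<phi>.tendsto z)
  moreover have "(\<lambda>n. m + inverse (real (Suc n))) \<longlonglongrightarrow> m + 0"
    by (intro tendsto_intros LIMSEQ_inverse_real_of_nat)
  ultimately have Jz: "J z \<le> m"
    using u LIMSEQ_le[of "\<lambda>n. J (u n)" "J z" "\<lambda>n. m + inverse (real (Suc n))" "m + 0"]
    by (auto intro: less_imp_le)
  have "B z x = \<phi> x" for x
  proof -
    define d where "d = B z x - \<phi> x"
    define c where "c = B x x"
    have c: "c \<ge> 0" using coercive[of x] a unfolding c_def
      by (meson less_imp_le mult_nonneg_nonneg order_trans zero_le_power2)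
    \<comment> \<open>This step length makes the first variation of \<open>J\<close> outweigh the quadratic term.\<close>
    define t where "t = - d / (c + 1)"
    have "J z \<le> J (z + t *\<^sub>R x)" using Jz m_le order_trans by blast
    also have "\<dots> = J z + 2 * t * d + t\<^sup>2 * c"
      by (simp add: J_def d_def c_def B.add_left B.add_right B.scaleR_left B.scaleR_right
          \<phi>.add \<phi>.scaleR sym[of x z] algebra_simps power2_eq_square)
    finally have "0 \<le> 2 * t * d + t\<^sup>2 * c" by simp
    also have "\<dots> = - (d\<^sup>2 * (c + 2)) / (c + 1)\<^sup>2"
      using c by (simp add: t_def divide_simps) (simp add: algebra_simps power2_eq_square)
    finally have "d\<^sup>2 * (c + 2) \<le> 0"
      using c by (simp add: divide_simps split: if_splits)
    then have "d = 0" using c by (simp add: mult_le_0_iff)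
    then show ?thesis by (simp add: d_def)
  qed
  then show thesis by (rule that)
qed

text \<open>
  It suffices to represent the real part of \<open>\<lambda>x. cinner (T x) y\<close>: the imaginary part is the
  real part at \<open>\<i> *\<^sub>C x\<close> up to sign.
\<close>

lemma cinner_cadjoint:
  fixes T :: "'a::chilbert_space \<Rightarrow> 'b::complex_inner"
  assumes "bounded_clinear T"
  shows "cinner (T x) y = cinner x (cadjoint T y)"
proof -
  have "\<exists>z. \<forall>x. cinner (T x) y = cinner x z" for y
  proof -
    have "bounded_linear (\<lambda>x. inner (T x) y)"
      using bounded_linear_compose[OF bounded_linear_inner_left
          bounded_clinear_bounded_linear[OF assms]] by simp
    then obtain z where z: "\<And>x. inner z x = inner (T x) y"
      by (rule symmetric_coercive_representation[OF bounded_bilinear_inner inner_commute zero_less_one,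
            rotated])
        (auto simp: power2_norm_eq_inner)
    have "cinner (T x) y = cinner x z" for x
      by (rule complex_eqI)
        (simp_all add: Re_cinner Im_cinner z inner_commute[of _ z]
          bounded_clinear_scaleC[OF assms, symmetric])
    then show ?thesis by blast
  qed
  then have "\<exists>T'. \<forall>x y. cinner (T x) y = cinner x (T' y)" by metis
  then show ?thesis unfolding cadjoint_def by (rule someI2_ex) blast
qed

lemma cinner_cadjoint_left:
  fixes T :: "'a::chilbert_space \<Rightarrow> 'b::complex_inner"
  assumes "bounded_clinear T"
  shows "cinner (cadjoint T y) x = cinner y (T x)"
  by (metis assms cinner_cadjoint cinner_commute)

lemma cinner_funpow_cadjoint:
  fixes A :: "'a::chilbert_space \<Rightarrow> 'a"
  assumes "bounded_clinear A"
  shows "cinner x ((A ^^ n) y) = cinner ((cadjoint A ^^ n) x) y"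
proof (induction n arbitrary: x)
  case (Suc n)
  show ?case
    using Suc[of "cadjoint A x"]
    by (simp add: cinner_cadjoint_left[OF assms] funpow_swap1[of "cadjoint A"])
qed simp

section \<open>Bessel sequences and their frame operators\<close>

definition energy :: "'k set \<Rightarrow> ('k \<Rightarrow> 'a::complex_inner) \<Rightarrow> 'a \<Rightarrow> real"
  where "energy K g x = (\<Sum>\<^sub>\<infinity>k\<in>K. (cmod (cinner x (g k)))\<^sup>2)"

lemma bessel_sequence_energy_le:
  assumes "bessel_sequence K g"
  obtains b where "b > 0" "\<And>x. energy K g x \<le> b * (norm x)\<^sup>2"
  using assms unfolding bessel_sequence_def energy_def by blast

lemma has_sum_energy:
  assumes "bessel_sequence K g"
  shows "((\<lambda>k. (cmod (cinner x (g k)))\<^sup>2) has_sum energy K g x) K"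
  using assms unfolding bessel_sequence_def energy_def by (auto intro: has_sum_infsum)

lemma bessel_sequenceI:
  assumes "\<And>x. ((\<lambda>k. (cmod (cinner x (g k)))\<^sup>2) has_sum e x) K"
    and "\<And>x. e x \<le> b * (norm x)\<^sup>2"
  shows "bessel_sequence K g"
  unfolding bessel_sequence_def
proof (intro exI[of _ "\<bar>b\<bar> + 1"] conjI allI)
  fix x
  have "e x \<le> (\<bar>b\<bar> + 1) * (norm x)\<^sup>2"
    using assms(2)[of x] by (smt (verit) mult_right_mono zero_le_power2)
  then show "(\<Sum>\<^sub>\<infinity>k\<in>K. (cmod (cinner x (g k)))\<^sup>2) \<le> (\<bar>b\<bar> + 1) * (norm x)\<^sup>2"
    using infsumI[OF assms(1)[of x]] by simp
qed (use assms(1) summable_on_def in \<open>auto\<close>)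

lemma is_frame_iff_energy_ge:
  "is_frame K g \<longleftrightarrow> bessel_sequence K g \<and> (\<exists>a>0. \<forall>x. a * (norm x)\<^sup>2 \<le> energy K g x)"
  unfolding is_frame_def bessel_sequence_def energy_def by blast

text \<open>
  Synthesis is the adjoint of analysis, so it satisfies the same bound: pair the sum \<open>v\<close> with itself
  and apply the Cauchy--Schwarz inequality to the coefficients \<open>c k\<close> and \<open>cinner (g k) v\<close>.
\<close>

lemma norm_synthesis_le:
  fixes g :: "'k \<Rightarrow> 'a::complex_inner"
  assumes "b \<ge> 0" and b: "\<And>x. (\<Sum>k\<in>F. (cmod (cinner x (g k)))\<^sup>2) \<le> b * (norm x)\<^sup>2"
  shows "(norm (\<Sum>k\<in>F. c k *\<^sub>C g k))\<^sup>2 \<le> b * (\<Sum>k\<in>F. (cmod (c k))\<^sup>2)"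
proof -
  define v where "v = (\<Sum>k\<in>F. c k *\<^sub>C g k)"
  define C where "C = (\<Sum>k\<in>F. (cmod (c k))\<^sup>2)"
  have C: "C \<ge> 0" by (simp add: C_def sum_nonneg)
  have "(norm v)\<^sup>2 = cmod (cinner v v)" by (simp add: cinner_self norm_power)
  also have "cinner v v = (\<Sum>k\<in>F. c k * cinner (g k) v)"
    by (subst v_def)
      (simp add: bounded_linear.linear[OF bounded_linear_cinner_left, THEN linear_sum]
        cinner_scaleC_left)
  also have "cmod \<dots> \<le> (\<Sum>k\<in>F. \<bar>cmod (c k)\<bar> * \<bar>cmod (cinner v (g k))\<bar>)"
    by (rule sum_norm_le) (metis abs_norm_cancel cinner_commute complex_mod_cnj norm_mult order_refl)
  also have "\<dots> \<le> L2_set (\<lambda>k. cmod (c k)) F * L2_set (\<lambda>k. cmod (cinner v (g k))) F"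
    by (rule L2_set_mult_ineq)
  finally have "((norm v)\<^sup>2)\<^sup>2 \<le> \<dots>\<^sup>2" by (rule power_mono) simp
  also have "\<dots> = C * (\<Sum>k\<in>F. (cmod (cinner v (g k)))\<^sup>2)"
    by (simp add: L2_set_def power_mult_distrib sum_nonneg C_def)
  also have "\<dots> \<le> C * (b * (norm v)\<^sup>2)" by (intro mult_left_mono b C)
  finally have "(norm v)\<^sup>2 * (norm v)\<^sup>2 \<le> (b * C) * (norm v)\<^sup>2"
    by (simp add: power2_eq_square[of "(norm v)\<^sup>2"] mult_ac)
  then have "(norm v)\<^sup>2 \<le> b * C" if "v \<noteq> 0"
    by (rule mult_right_le_imp_le) (use that in simp)
  moreover have "0 \<le> b * C" using C assms(1) by simp
  ultimately show ?thesis unfolding v_def[symmetric] C_def[symmetric]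
    by (cases "v = 0") simp_all
qed


lemma sum_cmod_cinner_le_energy:
  assumes "bessel_sequence K g" "finite F" "F \<subseteq> K"
  shows "(\<Sum>k\<in>F. (cmod (cinner x (g k)))\<^sup>2) \<le> energy K g x"
  using finite_sum_le_has_sum[OF has_sum_energy[OF assms(1)] assms(2,3)] by simp

lemma energy_nonneg: "0 \<le> energy K g x"
  unfolding energy_def by (rule infsum_nonneg) simp

lemma norm_bessel_sum_le:
  assumes "bessel_sequence K g" and b: "b > 0" "\<And>x. energy K g x \<le> b * (norm x)\<^sup>2"
    and F: "finite F" "F \<subseteq> K"
  shows "(norm (\<Sum>k\<in>F. c k *\<^sub>C g k))\<^sup>2 \<le> b * (\<Sum>k\<in>F. (cmod (c k))\<^sup>2)"
proof (rule norm_synthesis_le)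
  show "(\<Sum>k\<in>F. (cmod (cinner x (g k)))\<^sup>2) \<le> b * (norm x)\<^sup>2" for x
    using sum_cmod_cinner_le_energy[OF assms(1) F] b(2) order_trans by blast
qed (use b in simp)

text \<open>
  The series need not converge absolutely. It is Cauchy because, by the synthesis bound, the terms
  outside a finite set \<open>F0\<close> contribute at most the part of the energy that \<open>F0\<close> misses.
\<close>

lemma has_sum_frame_operator:
  fixes g :: "'k \<Rightarrow> 'a::chilbert_space"
  assumes "bessel_sequence K g"
  shows "((\<lambda>k. cinner x (g k) *\<^sub>C g k) has_sum frame_operator K g x) K"
proof -
  obtain b where b: "b > 0" "\<And>x. energy K g x \<le> b * (norm x)\<^sup>2"
    using bessel_sequence_energy_le[OF assms] by blast
  define s where "s F = (\<Sum>k\<in>F. cinner x (g k) *\<^sub>C g k)" for F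
  define q where "q F = (\<Sum>k\<in>F. (cmod (cinner x (g k)))\<^sup>2)" for F
  have close: "(norm (s F - s F0))\<^sup>2 \<le> b * (energy K g x - q F0)"
    if "finite F" "F \<subseteq> K" "F0 \<subseteq> F" for F F0
  proof -
    have "s F - s F0 = s (F - F0)" "q (F - F0) = q F - q F0"
      using that by (simp_all add: s_def q_def sum_diff)
    then have "(norm (s F - s F0))\<^sup>2 \<le> b * (q F - q F0)"
      using norm_bessel_sum_le[OF assms b, of "F - F0" "\<lambda>k. cinner x (g k)"] that
      by (simp add: s_def q_def subset_iff)
    also have "\<dots> \<le> b * (energy K g x - q F0)"
      using b sum_cmod_cinner_le_energy[OF assms that(1,2), of x] by (simp add: q_def)
    finally show ?thesis .
  qed
  have "cauchy_filter (filtermap s (finite_subsets_at_top K))"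
    unfolding cauchy_filter_metric_filtermap
  proof (intro allI impI)
    fix e :: real assume e: "e > 0"
    have "(q \<longlongrightarrow> energy K g x) (finite_subsets_at_top K)"
      using has_sum_energy[OF assms, of x] by (simp add: has_sum_def q_def[abs_def])
    moreover have "energy K g x - (e / 2)\<^sup>2 / b < energy K g x" using e b by simp
    ultimately have "\<forall>\<^sub>F F in finite_subsets_at_top K. energy K g x - (e / 2)\<^sup>2 / b < q F"
      by (rule order_tendstoD)
    then obtain F0 where F0: "finite F0" "F0 \<subseteq> K" "energy K g x - (e / 2)\<^sup>2 / b < q F0"
      unfolding eventually_finite_subsets_at_top by blast
    have near: "dist (s F) (s F0) < e / 2" if "finite F" "F0 \<subseteq> F" "F \<subseteq> K" for F
    proof -
      have "(norm (s F - s F0))\<^sup>2 \<le> b * (energy K g x - q F0)" using close that by simp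
      also have "\<dots> < (e / 2)\<^sup>2" using F0(3) b by (simp add: field_simps)
      finally have "norm (s F - s F0) < e / 2" by (rule power_less_imp_less_base) (use e in simp)
      then show ?thesis by (simp only: dist_norm)
    qed
    show "\<exists>P. eventually P (finite_subsets_at_top K) \<and>
        (\<forall>F F'. P F \<and> P F' \<longrightarrow> dist (s F) (s F') < e)"
    proof (intro exI conjI allI impI)
      show "\<forall>\<^sub>F F in finite_subsets_at_top K. finite F \<and> F0 \<subseteq> F \<and> F \<subseteq> K"
        using F0 by (auto simp: eventually_finite_subsets_at_top)
    qed (metis near dist_triangle_half_l)
  qed
  moreover have "complete (UNIV :: 'a set)"
    by (meson Cauchy_convergent UNIV_I complete_def convergent_def)
  ultimately obtain L where "(s \<longlongrightarrow> L) (finite_subsets_at_top K)"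
    using complete_uniform[where S = "UNIV :: 'a set"] by (force simp: filterlim_def)
  then have "(\<lambda>k. cinner x (g k) *\<^sub>C g k) summable_on K"
    unfolding summable_on_def has_sum_def s_def by blast
  then show ?thesis unfolding frame_operator_def by (rule has_sum_infsum)
qed

lemma has_sum_cinner_frame_operator:
  fixes g :: "'k \<Rightarrow> 'a::chilbert_space"
  assumes "bessel_sequence K g"
  shows "((\<lambda>k. cinner x (g k) * cinner (g k) y) has_sum cinner (frame_operator K g x) y) K"
  using has_sum_bounded_linear[OF bounded_linear_cinner_left has_sum_frame_operator[OF assms]]
  by (simp add: cinner_scaleC_left)

lemma cinner_frame_operator_self:
  fixes g :: "'k \<Rightarrow> 'a::chilbert_space"
  assumes "bessel_sequence K g"
  shows "cinner (frame_operator K g x) x = complex_of_real (energy K g x)"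
proof -
  have "cinner x (g k) * cinner (g k) x = complex_of_real ((cmod (cinner x (g k)))\<^sup>2)" for k
    by (subst cinner_commute[of "g k" x]) (rule complex_norm_square[symmetric])
  then show ?thesis
    using has_sum_unique[OF has_sum_cinner_frame_operator[OF assms, of x x]]
      has_sum_bounded_linear[OF bounded_linear_of_real has_sum_energy[OF assms, of x]]
    by simp
qed

lemma inner_frame_operator_self:
  fixes g :: "'k \<Rightarrow> 'a::chilbert_space"
  assumes "bessel_sequence K g"
  shows "inner (frame_operator K g x) x = energy K g x"
  by (simp add: Re_cinner[symmetric] cinner_frame_operator_self[OF assms])

lemma cinner_frame_operator_commute:
  fixes g :: "'k \<Rightarrow> 'a::chilbert_space"
  assumes "bessel_sequence K g"
  shows "cinner (frame_operator K g x) y = cinner x (frame_operator K g y)"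
proof -
  have "((\<lambda>k. cnj (cinner y (g k) * cinner (g k) x)) has_sum cnj (cinner (frame_operator K g y) x)) K"
    by (rule has_sum_bounded_linear[OF bounded_linear_cnj has_sum_cinner_frame_operator[OF assms]])
  then have "((\<lambda>k. cinner x (g k) * cinner (g k) y) has_sum cinner x (frame_operator K g y)) K"
    by (simp add: cinner_commute[symmetric] mult.commute)
  then show ?thesis using has_sum_unique has_sum_cinner_frame_operator[OF assms] by blast
qed

lemma norm_frame_operator_le:
  fixes g :: "'k \<Rightarrow> 'a::chilbert_space"
  assumes "bessel_sequence K g" and b: "b > 0" "\<And>x. energy K g x \<le> b * (norm x)\<^sup>2"
  shows "(norm (frame_operator K g x))\<^sup>2 \<le> b * energy K g x"
proof (rule tendsto_upperbound)
  show "((\<lambda>F. (norm (\<Sum>k\<in>F. cinner x (g k) *\<^sub>C g k))\<^sup>2) \<longlongrightarrow> (norm (frame_operator K g x))\<^sup>2)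
      (finite_subsets_at_top K)"
    using has_sum_frame_operator[OF assms(1), of x] unfolding has_sum_def
    by (intro tendsto_intros)
  have "(norm (\<Sum>k\<in>F. cinner x (g k) *\<^sub>C g k))\<^sup>2 \<le> b * energy K g x"
    if "finite F" "F \<subseteq> K" for F
    using norm_bessel_sum_le[OF assms that, of "\<lambda>k. cinner x (g k)"]
      mult_left_mono[OF sum_cmod_cinner_le_energy[OF assms(1) that, of x], of b] b(1)
    by linarith
  then show "\<forall>\<^sub>F F in finite_subsets_at_top K.
      (norm (\<Sum>k\<in>F. cinner x (g k) *\<^sub>C g k))\<^sup>2 \<le> b * energy K g x"
    by (rule eventually_finite_subsets_at_top_weakI)
qed simp

lemma bounded_clinear_frame_operator:
  fixes g :: "'k \<Rightarrow> 'a::chilbert_space"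
  assumes "bessel_sequence K g"
  shows "bounded_clinear (frame_operator K g)"
proof -
  obtain b where b: "b > 0" "\<And>x. energy K g x \<le> b * (norm x)\<^sup>2"
    using bessel_sequence_energy_le[OF assms] by blast
  note S = cinner_frame_operator_commute[OF assms, symmetric]
  show ?thesis
  proof (rule bounded_clinearI)
    show "frame_operator K g (x + y) = frame_operator K g x + frame_operator K g y" for x y
      by (rule eq_if_cinner_left_eq) (simp add: S cinner_add_right)
    show "frame_operator K g (c *\<^sub>C x) = c *\<^sub>C frame_operator K g x" for c x
      by (rule eq_if_cinner_left_eq) (simp add: S cinner_scaleC_right)
    have "(norm (frame_operator K g x))\<^sup>2 \<le> (norm x * b)\<^sup>2" for x
      using norm_frame_operator_le[OF assms b, of x] mult_left_mono[OF b(2)[of x], of b] b(1)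
      by (auto simp: power_mult_distrib power2_eq_square[of b] mult_ac intro: order_trans)
    then show "norm (frame_operator K g x) \<le> norm x * b" for x
      by (rule power2_le_imp_le) (use b in simp)
  qed
qed

text \<open>
  The lower frame bound is coercivity of the frame operator \<open>S\<close>, which makes it injective with
  bounded inverse and, by the representation lemma, onto. Conversely
  \<open>(norm (S x))\<^sup>2 \<le> b * energy K g x\<close>, so an inverse bounded by \<open>k\<close> forces
  \<open>(norm x)\<^sup>2 \<le> k\<^sup>2 * b * energy K g x\<close>.
\<close>

lemma is_frame_iff_boundedly_invertible_frame_operator:
  fixes g :: "'k \<Rightarrow> 'a::chilbert_space"
  shows "is_frame K g \<longleftrightarrow> bessel_sequence K g \<and> boundedly_invertible (frame_operator K g)"
proof (intro iffI conjI)
  assume "is_frame K g"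
  then obtain a where bessel: "bessel_sequence K g" and
    a: "a > 0" "\<And>x. a * (norm x)\<^sup>2 \<le> energy K g x"
    by (auto simp: is_frame_iff_energy_ge)
  then show "bessel_sequence K g" by blast
  let ?S = "frame_operator K g"
  note S = bounded_clinear_frame_operator[OF bessel]
  interpret S: bounded_linear ?S using S by (rule bounded_clinear_bounded_linear)
  have below: "a * norm x \<le> norm (?S x)" for x
  proof (cases "x = 0")
    case False
    have "a * norm x * norm x \<le> norm (?S x) * norm x"
      using a(2)[of x] norm_cauchy_schwarz[of "?S x" x]
      by (simp add: inner_frame_operator_self[OF bessel] power2_eq_square mult_ac)
    then show ?thesis using False by simp
  qed simp
  have inj: "inj ?S"
  proof (rule injI)
    fix x y assume "?S x = ?S y"
    then show "x = y" using below[of "x - y"] a by (simp add: S.diff mult_le_0_iff)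
  qed
  have "y \<in> range ?S" for y
  proof -
    have "bounded_bilinear (\<lambda>z x. inner (?S z) x)"
      by (rule bounded_bilinear.comp1[OF bounded_bilinear_inner S.bounded_linear])
    moreover have "inner (?S x) z = inner (?S z) x" for x z
      by (metis Re_cinner cinner_frame_operator_commute[OF bessel] inner_commute)
    moreover have "a * (norm x)\<^sup>2 \<le> inner (?S x) x" for x
      by (simp add: inner_frame_operator_self[OF bessel] a)
    ultimately obtain z where "\<And>x. inner (?S z) x = inner y x"
      using symmetric_coercive_representation[of "\<lambda>z x. inner (?S z) x" a "inner y"] a(1)
        bounded_linear_inner_right by blast
    then have "?S z = y" using vector_eq_rdot by blast
    then show ?thesis by blast
  qed
  then have "surj ?S" by blast
  then have ST: "?S (inv ?S y) = y" for y by (rule surj_f_inv_f)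
  have "bounded_clinear (inv ?S)"
  proof (rule bounded_clinearI)
    show "inv ?S (x + y) = inv ?S x + inv ?S y" for x y
      by (rule injD[OF inj]) (simp add: ST S.add)
    show "inv ?S (c *\<^sub>C x) = c *\<^sub>C inv ?S x" for c x
      by (rule injD[OF inj]) (simp add: ST bounded_clinear_scaleC[OF S])
    show "norm (inv ?S x) \<le> norm x * inverse a" for x
      using below[of "inv ?S x"] a by (simp add: ST field_simps)
  qed
  then show "boundedly_invertible ?S"
    unfolding boundedly_invertible_def using ST inj by (auto simp: fun_eq_iff intro!: exI[of _ "inv ?S"])
next
  let ?S = "frame_operator K g"
  assume "bessel_sequence K g \<and> boundedly_invertible ?S"
  then obtain T where bessel: "bessel_sequence K g" and T: "bounded_clinear T" "T \<circ> ?S = id"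
    unfolding boundedly_invertible_def by blast
  obtain b where b: "b > 0" "\<And>x. energy K g x \<le> b * (norm x)\<^sup>2"
    using bessel_sequence_energy_le[OF bessel] by blast
  obtain k where k: "k > 0" "\<And>x. norm (T x) \<le> norm x * k"
    using bounded_linear.pos_bounded[OF bounded_clinear_bounded_linear[OF T(1)]] by blast
  have "inverse (k\<^sup>2 * b) * (norm x)\<^sup>2 \<le> energy K g x" for x
  proof -
    have "norm x \<le> norm (?S x) * k" using k(2)[of "?S x"] T(2) by (simp add: fun_eq_iff)
    then have "(norm x)\<^sup>2 \<le> (norm (?S x))\<^sup>2 * k\<^sup>2"
      by (metis norm_ge_zero power_mono power_mult_distrib)
    also have "\<dots> \<le> b * energy K g x * k\<^sup>2"
      by (intro mult_right_mono norm_frame_operator_le[OF bessel b]) simp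
    finally show ?thesis using k(1) b(1) by (simp add: field_simps)
  qed
  moreover have "inverse (k\<^sup>2 * b) > 0" using k b by simp
  ultimately show "is_frame K g" unfolding is_frame_iff_energy_ge using bessel by blast
qed

section \<open>Orbit systems and the Stein equation\<close>

lemma orbit_system_0 [simp]: "orbit_system A f (0, i) = f i"
  and orbit_system_Suc [simp]: "orbit_system A f (Suc n, i) = A (orbit_system A f (n, i))"
  by (simp_all add: orbit_system_def)

lemma cinner_orbit_system:
  fixes A :: "'a::chilbert_space \<Rightarrow> 'a"
  assumes "bounded_clinear A"
  shows "cinner x (orbit_system A f (n, i)) = cinner ((cadjoint A ^^ n) x) (f i)"
  by (simp add: orbit_system_def cinner_funpow_cadjoint[OF assms])

lemma has_sum_split_first_layer:
  fixes h :: "nat \<times> 'i \<Rightarrow> 'b::topological_comm_monoid_add"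
  assumes "((\<lambda>i. h (0, i)) has_sum a) I"
    and "((\<lambda>(n, i). h (Suc n, i)) has_sum b) (UNIV \<times> I)"
  shows "(h has_sum (a + b)) (UNIV \<times> I)"
proof -
  have "(h has_sum a) (Pair 0 ` I)"
    using assms(1) by (subst has_sum_reindex) (auto simp: o_def inj_on_def)
  moreover have "(h has_sum b) (map_prod Suc id ` (UNIV \<times> I))"
    using assms(2) by (subst has_sum_reindex) (auto simp: o_def inj_on_def map_prod_def case_prod_beta')
  moreover have "UNIV \<times> I = Pair 0 ` I \<union> map_prod Suc id ` (UNIV \<times> I)"
  proof (intro equalityI subsetI)
    fix p :: "nat \<times> 'i" assume "p \<in> UNIV \<times> I"
    then show "p \<in> Pair 0 ` I \<union> map_prod Suc id ` (UNIV \<times> I)"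
      by (cases p; cases "fst p") (auto intro!: image_eqI[where x = "(_, _)"])
  qed auto
  ultimately show ?thesis
    using has_sum_Un_disjoint[of h "Pair 0 ` I" a "map_prod Suc id ` (UNIV \<times> I)" b] by auto
qed

lemma bessel_sequence_orbit_system_generators:
  fixes f :: "'i \<Rightarrow> 'a::complex_inner"
  assumes "bessel_sequence (UNIV \<times> I) (orbit_system A f)"
  shows "bessel_sequence I f"
proof -
  let ?c = "\<lambda>x p. (cmod (cinner x (orbit_system A f p)))\<^sup>2"
  obtain b where b: "\<And>x. energy (UNIV \<times> I) (orbit_system A f) x \<le> b * (norm x)\<^sup>2"
    using bessel_sequence_energy_le[OF assms] by blast
  have inj: "inj_on (Pair (0 :: nat)) I" by (simp add: inj_on_def)
  have "?c x summable_on Pair 0 ` I" for x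
    by (rule summable_on_subset_banach[OF has_sum_imp_summable[OF has_sum_energy[OF assms]]]) auto
  then have sum: "(?c x has_sum infsum (?c x) (Pair 0 ` I)) (Pair 0 ` I)" for x
    by (rule has_sum_infsum)
  show ?thesis
  proof (rule bessel_sequenceI)
    show "((\<lambda>i. (cmod (cinner x (f i)))\<^sup>2) has_sum infsum (?c x) (Pair 0 ` I)) I" for x
      using sum[of x] by (simp add: has_sum_reindex[OF inj] o_def)
    have "infsum (?c x) (Pair 0 ` I) \<le> energy (UNIV \<times> I) (orbit_system A f) x" for x
      by (rule has_sum_mono'[OF sum has_sum_energy[OF assms]]) auto
    then show "infsum (?c x) (Pair 0 ` I) \<le> b * (norm x)\<^sup>2" for x
      using b order_trans by blast
  qed
qed

text \<open>
  Split the frame series of \<open>x\<close> at \<open>n = 0\<close>. The layer \<open>n = 0\<close> is the frame operator of the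
  generators, and in the remaining terms \<open>cinner x (A y) = cinner (cadjoint A x) y\<close> lets one
  \<open>A\<close> be pulled out of the series.
\<close>

lemma frame_operator_orbit_system_stein:
  fixes A :: "'a::chilbert_space \<Rightarrow> 'a"
  assumes A: "bounded_clinear A"
    and bessel: "bessel_sequence (UNIV \<times> I) (orbit_system A f)"
  shows "frame_operator (UNIV \<times> I) (orbit_system A f) x =
    frame_operator I f x + A (frame_operator (UNIV \<times> I) (orbit_system A f) (cadjoint A x))"
proof -
  let ?g = "orbit_system A f"
  let ?S = "frame_operator (UNIV \<times> I) ?g"
  have "((\<lambda>p. A (cinner (cadjoint A x) (?g p) *\<^sub>C ?g p)) has_sum A (?S (cadjoint A x))) (UNIV \<times> I)"
    by (rule has_sum_bounded_linear[OF bounded_clinear_bounded_linear[OF A]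
          has_sum_frame_operator[OF bessel]])
  then have "((\<lambda>(n, i). cinner x (?g (Suc n, i)) *\<^sub>C ?g (Suc n, i)) has_sum A (?S (cadjoint A x)))
      (UNIV \<times> I)"
    by (simp add: case_prod_beta' bounded_clinear_scaleC[OF A] cinner_cadjoint_left[OF A])
  moreover have "((\<lambda>i. cinner x (?g (0, i)) *\<^sub>C ?g (0, i)) has_sum frame_operator I f x) I"
    using has_sum_frame_operator[OF bessel_sequence_orbit_system_generators[OF bessel]] by simp
  ultimately have "((\<lambda>p. cinner x (?g p) *\<^sub>C ?g p) has_sum
      (frame_operator I f x + A (?S (cadjoint A x)))) (UNIV \<times> I)"
    by (intro has_sum_split_first_layer)
  then show ?thesis using has_sum_unique has_sum_frame_operator[OF bessel] by blast
qed

lemma iterate_recurrence: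
  fixes v w :: "'a \<Rightarrow> 'b::ab_group_add"
  assumes "\<And>x. v x = w x + v (T x)"
  shows "v x = (\<Sum>k<n. w ((T ^^ k) x)) + v ((T ^^ n) x)"
proof (induction n)
  case (Suc n)
  show ?case using Suc assms[of "(T ^^ n) x"] by (simp add: add.assoc)
qed simp

lemma inner_stein:
  fixes A :: "'a::chilbert_space \<Rightarrow> 'a"
  assumes A: "bounded_clinear A" and bessel: "bessel_sequence I f"
    and stein: "\<And>x. A (S (cadjoint A x)) = S x - frame_operator I f x"
  shows "inner (S x) x = energy I f x + inner (S (cadjoint A x)) (cadjoint A x)"
proof -
  have "inner (S (cadjoint A x)) (cadjoint A x) = inner (A (S (cadjoint A x))) x"
    by (simp add: Re_cinner[symmetric] cinner_cadjoint[OF A])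
  then show ?thesis
    by (simp add: stein inner_diff_left inner_frame_operator_self[OF bessel])
qed

text \<open>
  With \<open>q\<close> the energy functional of the orbit system, the Stein equation says that
  \<open>q ((cadjoint A ^^ n) x)\<close> is the tail from \<open>n\<close> on of the convergent series \<open>q x\<close>; the lower
  frame bound then controls \<open>norm ((cadjoint A ^^ n) x)\<close>.
\<close>

lemma strongly_stable_cadjoint_if_is_frame:
  fixes A :: "'a::chilbert_space \<Rightarrow> 'a"
  assumes A: "bounded_clinear A"
    and frame: "is_frame (UNIV \<times> I) (orbit_system A f)"
  shows "strongly_stable (cadjoint A)"
  unfolding strongly_stable_def
proof
  fix x
  let ?g = "orbit_system A f"
  let ?x = "\<lambda>n. (cadjoint A ^^ n) x"
  let ?S = "frame_operator (UNIV \<times> I) ?g"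
  let ?q = "energy (UNIV \<times> I) ?g"
  obtain a where bessel: "bessel_sequence (UNIV \<times> I) ?g"
    and a: "a > 0" "\<And>x. a * (norm x)\<^sup>2 \<le> ?q x"
    using frame by (auto simp: is_frame_iff_energy_ge)
  note bessel_f = bessel_sequence_orbit_system_generators[OF bessel]
  have "A (?S (cadjoint A x)) = ?S x - frame_operator I f x" for x
    unfolding frame_operator_orbit_system_stein[OF A bessel, of x] by simp
  then have "?q x = energy I f x + ?q (cadjoint A x)" for x
    using inner_stein[OF A bessel_f, of ?S x] inner_frame_operator_self[OF bessel] by metis
  then have "?q x = (\<Sum>k<n. energy I f (?x k)) + ?q (?x n)" for n
    by (rule iterate_recurrence)
  then have tail: "?q x - (\<Sum>k<n. energy I f (?x k)) = ?q (?x n)" for n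
    by (metis add_diff_cancel_left')
  have "((\<lambda>n. energy I f (?x n)) has_sum ?q x) UNIV"
    using has_sum_SigmaD[OF has_sum_energy[OF bessel, of x]] has_sum_energy[OF bessel_f]
    by (simp add: cinner_orbit_system[OF A])
  then have "(\<lambda>n. \<Sum>k<n. energy I f (?x k)) \<longlonglongrightarrow> ?q x"
    unfolding sums_def[symmetric] by (rule has_sum_imp_sums)
  then have "(\<lambda>n. ?q x - (\<Sum>k<n. energy I f (?x k))) \<longlonglongrightarrow> ?q x - ?q x"
    by (intro tendsto_intros)
  then have "(\<lambda>n. ?q (?x n) / a) \<longlonglongrightarrow> 0"
    unfolding tail by (intro tendsto_divide_zero) simp
  moreover have "norm ((norm (?x n))\<^sup>2) \<le> ?q (?x n) / a" for n
    using a by (simp add: field_simps)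
  ultimately have "(\<lambda>n. (norm (?x n))\<^sup>2) \<longlonglongrightarrow> 0"
    by (intro Lim_null_comparison[where f = "\<lambda>n. (norm (?x n))\<^sup>2"]) auto
  then show "?x \<longlonglongrightarrow> 0"
    by (simp add: tendsto_norm_zero_iff)
qed

text \<open>
  Iterating the Stein equation writes \<open>inner (S x) x\<close> as the energy of the first \<open>n\<close> layers plus
  \<open>inner (S u) u\<close> for \<open>u = (cadjoint A ^^ n) x\<close>, and stability makes the remainder vanish.
\<close>

lemma bessel_sequence_orbit_system_if_stein:
  fixes A :: "'a::chilbert_space \<Rightarrow> 'a"
  assumes A: "bounded_clinear A" and stable: "strongly_stable (cadjoint A)"
    and bessel: "bessel_sequence I f" and S: "bounded_linear S"
    and stein: "\<And>x. A (S (cadjoint A x)) = S x - frame_operator I f x"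
  shows "bessel_sequence (UNIV \<times> I) (orbit_system A f)"
proof -
  let ?c = "\<lambda>x p. (cmod (cinner x (orbit_system A f p)))\<^sup>2"
  interpret S: bounded_linear S by fact
  obtain K where K: "\<And>x. norm (S x) \<le> norm x * K" using S.bounded by blast
  show ?thesis
  proof (rule bessel_sequenceI)
    fix x
    let ?x = "\<lambda>n. (cadjoint A ^^ n) x"
    have lim: "?x \<longlonglongrightarrow> 0" using stable by (simp add: strongly_stable_def)
    have "(\<lambda>n. inner (S x) x - inner (S (?x n)) (?x n)) \<longlonglongrightarrow> inner (S x) x - inner (S 0) 0"
      by (intro tendsto_intros S.tendsto lim)
    moreover have "(\<Sum>k<n. energy I f (?x k)) = inner (S x) x - inner (S (?x n)) (?x n)" for n
      using iterate_recurrence[where v = "\<lambda>x. inner (S x) x", OF inner_stein[OF A bessel stein], of x n]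
      by simp
    ultimately have "(\<lambda>n. energy I f (?x n)) sums inner (S x) x"
      by (simp add: sums_def)
    then have sum: "((\<lambda>n. energy I f (?x n)) has_sum inner (S x) x) UNIV"
      by (rule sums_nonneg_imp_has_sum) (rule energy_nonneg)
    have layer: "((\<lambda>i. ?c x (n, i)) has_sum energy I f (?x n)) I" for n
      using has_sum_energy[OF bessel] by (simp add: cinner_orbit_system[OF A])
    have "?c x summable_on (UNIV \<times> I)"
      by (rule summable_on_SigmaI[OF layer has_sum_imp_summable[OF sum]]) simp
    then show "(?c x has_sum inner (S x) x) (UNIV \<times> I)"
      by (rule has_sum_SigmaI[OF layer sum])
    show "inner (S x) x \<le> K * (norm x)\<^sup>2"
      using norm_cauchy_schwarz[of "S x" x] mult_right_mono[OF K[of x], of "norm x"]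
      by (simp add: power2_eq_square mult_ac)
  qed
qed

text \<open>
  The difference \<open>D\<close> of two solutions satisfies \<open>A \<circ> D \<circ> cadjoint A = D\<close>, hence
  \<open>cinner (D x) y = cinner (D u) v\<close> where \<open>u\<close> and \<open>v\<close> are the \<open>n\<close>th iterates of \<open>x\<close> and \<open>y\<close>
  under \<open>cadjoint A\<close>; both tend to 0.
\<close>

lemma stein_solution_unique:
  fixes A :: "'a::chilbert_space \<Rightarrow> 'a"
  assumes A: "bounded_clinear A" and stable: "strongly_stable (cadjoint A)"
    and S: "bounded_linear S" "bounded_linear S'"
    and stein: "\<And>x. A (S (cadjoint A x)) = S x - F x" "\<And>x. A (S' (cadjoint A x)) = S' x - F x"
  shows "S = S'"
proof
  fix x
  define D where "D x = S x - S' x" for x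
  interpret D: bounded_linear D unfolding D_def by (intro bounded_linear_sub S)
  interpret A: bounded_linear A using A by (rule bounded_clinear_bounded_linear)
  have D: "A (D (cadjoint A x)) = D x" for x
    by (simp add: D_def A.diff stein)
  define u where "u n x = (cadjoint A ^^ n) x" for n x
  have iterate: "cinner (D x) y = cinner (D (u n x)) (u n y)" for n y
    by (induction n) (simp_all add: u_def cinner_cadjoint[OF A, symmetric] D)
  have lim: "(\<lambda>n. u n y) \<longlonglongrightarrow> 0" for y
    using stable by (simp add: strongly_stable_def u_def)
  have "inner (D x) y = 0" for y
  proof -
    have "(\<lambda>n. inner (D (u n x)) (u n y)) \<longlonglongrightarrow> inner (D 0) 0"
      by (intro tendsto_intros D.tendsto lim)
    moreover have "inner (D (u n x)) (u n y) = inner (D x) y" for n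
      by (metis Re_cinner iterate)
    ultimately show ?thesis by (simp add: LIMSEQ_const_iff)
  qed
  then have "D x = 0" by (metis inner_eq_zero_iff)
  then show "S x = S' x" by (simp add: D_def)
qed

theorem theorem3p2:
  fixes A :: "'h::chilbert_space \<Rightarrow> 'h"
    and I :: "'i set"
    and f :: "'i \<Rightarrow> 'h"
  assumes "separable_space (euclidean :: 'h topology)"
    and "bounded_clinear A"
    and "countable I"
  shows
    "(is_frame (UNIV \<times> I) (orbit_system A f) \<longleftrightarrow>
        strongly_stable (cadjoint A) \<and>
        bessel_sequence I f \<and>
        (\<exists>S. bounded_clinear S \<and> boundedly_invertible S \<and>
           (\<forall>x. A (S (cadjoint A x)) = S x - frame_operator I f x))) \<and>
     (\<forall>S. strongly_stable (cadjoint A) \<and>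
        bessel_sequence I f \<and>
        bounded_clinear S \<and> boundedly_invertible S \<and>
        (\<forall>x. A (S (cadjoint A x)) = S x - frame_operator I f x) \<longrightarrow>
        S = frame_operator (UNIV \<times> I) (orbit_system A f))"
proof -
  note A = assms(2)
  let ?g = "orbit_system A f"
  let ?S = "frame_operator (UNIV \<times> I) ?g"
  have stein: "A (?S (cadjoint A x)) = ?S x - frame_operator I f x"
    if "bessel_sequence (UNIV \<times> I) ?g" for x
    unfolding frame_operator_orbit_system_stein[OF A that, of x] by simp
  have solution: "bessel_sequence (UNIV \<times> I) ?g \<and> S = ?S"
    if "strongly_stable (cadjoint A)" "bessel_sequence I f" "bounded_clinear S"
      "\<forall>x. A (S (cadjoint A x)) = S x - frame_operator I f x" for S
  proof
    have S: "bounded_linear S" using that(3) by (rule bounded_clinear_bounded_linear)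
    show bessel: "bessel_sequence (UNIV \<times> I) ?g"
      using bessel_sequence_orbit_system_if_stein[OF A that(1,2) S] that(4) by blast
    show "S = ?S"
      using stein_solution_unique[OF A that(1) S bounded_clinear_bounded_linear[OF
          bounded_clinear_frame_operator[OF bessel]], of "frame_operator I f"] stein[OF bessel] that(4)
      by blast
  qed
  have "strongly_stable (cadjoint A) \<and> bessel_sequence I f \<and> bounded_clinear ?S \<and>
      boundedly_invertible ?S \<and> (\<forall>x. A (?S (cadjoint A x)) = ?S x - frame_operator I f x)"
    if frame: "is_frame (UNIV \<times> I) ?g"
  proof -
    have bessel: "bessel_sequence (UNIV \<times> I) ?g" and "boundedly_invertible ?S"
      using frame by (simp_all add: is_frame_iff_boundedly_invertible_frame_operator)
    then show ?thesis
      using strongly_stable_cadjoint_if_is_frame[OF A frame]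
        bessel_sequence_orbit_system_generators[OF bessel]
        bounded_clinear_frame_operator[OF bessel] stein[OF bessel] by blast
  qed
  moreover have "is_frame (UNIV \<times> I) ?g"
    if "strongly_stable (cadjoint A)" "bessel_sequence I f" "bounded_clinear S"
      "boundedly_invertible S" "\<forall>x. A (S (cadjoint A x)) = S x - frame_operator I f x" for S
    using solution[OF that(1-3,5)] that(4)
    by (simp add: is_frame_iff_boundedly_invertible_frame_operator)
  ultimately show ?thesis using solution by blast
qed

end
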